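(* Let $s\ge 2$ be an integer and $A_s=\{e_0,\dots,e_{s-1}\}$ with $0<e_0<e_1<\dots<e_{s-1}$. The following are equivalent: (i) the set $E$ of values of all infinite $A_s$-continued fractions is an interval and the coding system of numbers by means of $A_s$-continued fractions has zero redundancy; (ii) $e_0,e_1,\dots,e_{s-1}$ are consecutive terms of an arithmetic progression with common difference $d=d_1-d_0$, i.e. $e_i-e_{i-1}=d_1-d_0$ for all $i\in\{1,\dots,s-1\}$. Moreover, in this case $e_0e_{s-1}=\dfrac{(s-1)^2}{s}$.
   Context: For a sequence $(a_n)_{n\ge1}$ with $a_n\in A_s$, $[0;a_1,a_2,\dots]$ denotes the value of the infinite continued fraction $\cfrac{1}{a_1+\cfrac{1}{a_2+\cdots}}$, i.e. the limit of its convergents, which exists for all such sequences. $E=\{[0;a_1,a_2,\dots]: a_n\in A_s\text{ for all } n\}$. Put $p=e_0e_{s-1}$, $d_0=\min E=\dfrac{\sqrt{p(p+4)}-p}{2e_{s-1}}$ and $d_1=\max E=\dfrac{\sqrt{p(p+4)}-p}{2e_0}$. A representation of $x\in E$ is a sequence $(a_n)$ in $A_s$ with $x=[0;a_1,a_2,\dots]$. The coding system has zero redundancy if each $x\in E$ has at most two representations and the set of $x\in E$ having two distinct representations is at most countable. *)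

theory Defs
  imports "HOL-Analysis.Analysis"
begin

text \<open>Digit sequences are indexed from 0, so \<open>a n\<close> stands for the partial quotient \<open>a\<^sub>n\<^sub>+\<^sub>1\<close>
  and \<open>cf_convergent a n\<close> is \<open>[0; a 0, \<dots>, a (n - 1)]\<close>.\<close>

primrec cf_convergent :: "(nat \<Rightarrow> real) \<Rightarrow> nat \<Rightarrow> real" where
  "cf_convergent a 0 = 0"
| "cf_convergent a (Suc n) = 1 / (a 0 + cf_convergent (\<lambda>k. a (Suc k)) n)"

definition cf_representations :: "real set \<Rightarrow> real \<Rightarrow> (nat \<Rightarrow> real) set" where
  "cf_representations A x = {a. (\<forall>n. a n \<in> A) \<and> cf_convergent a \<longlonglongrightarrow> x}"

definition cf_values :: "real set \<Rightarrow> real set" where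
  "cf_values A = {x. \<exists>a. (\<forall>n. a n \<in> A) \<and> cf_convergent a \<longlonglongrightarrow> x}"

definition zero_redundancy :: "real set \<Rightarrow> bool" where
  "zero_redundancy A \<longleftrightarrow>
     (\<forall>x\<in>cf_values A. finite (cf_representations A x) \<and> card (cf_representations A x) \<le> 2) \<and>
     countable {x \<in> cf_values A.
       \<exists>a\<in>cf_representations A x. \<exists>b\<in>cf_representations A x. a \<noteq> b}"

text \<open>Both extrema exist for the digit sets considered here; see \<open>cf_min_eq\<close> and \<open>cf_max_eq\<close> below,
  which also give their closed forms.\<close>

definition cf_min :: "real set \<Rightarrow> real" where
  "cf_min A = (LEAST x. x \<in> cf_values A)"

definition cf_max :: "real set \<Rightarrow> real" where
  "cf_max A = (GREATEST x. x \<in> cf_values A)"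


subsection \<open>Convergence and the extreme values\<close>

primrec cf_tail :: "(nat \<Rightarrow> real) \<Rightarrow> nat \<Rightarrow> real \<Rightarrow> real" where
  "cf_tail a 0 t = t"
| "cf_tail a (Suc n) t = 1 / (a 0 + cf_tail (\<lambda>k. a (Suc k)) n t)"

lemma cf_convergent_eq_tail: "cf_convergent a n = cf_tail a n 0"
  by (induction n arbitrary: a) auto

lemma cf_convergent_add:
  "cf_convergent a (n + m) = cf_tail a n (cf_convergent (\<lambda>k. a (n + k)) m)"
  by (induction n arbitrary: a) auto

lemma cf_tail_nonneg:
  assumes "\<And>n. a n > 0" "t \<ge> 0"
  shows "cf_tail a n t \<ge> 0"
  using assms
proof (induction n arbitrary: a)
  case (Suc n)
  have "cf_tail (\<lambda>k. a (Suc k)) n t \<ge> 0"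
    by (rule Suc.IH) (use Suc.prems in simp_all)
  then show ?case using Suc.prems(1)[of 0] by simp
qed auto

lemma cf_step2_contract:
  fixes a b x y c :: real
  assumes "c > 0" "a \<ge> c" "b \<ge> c" "x \<ge> 0" "y \<ge> 0"
  shows "\<bar>1 / (a + 1 / (b + x)) - 1 / (a + 1 / (b + y))\<bar> \<le> \<bar>x - y\<bar> / (1 + c^2)"
proof -
  have pos: "b + x > 0" "b + y > 0" "a > 0" using assms by auto
  have ge: "a * (b + z) + 1 \<ge> 1 + c^2" if "z \<ge> 0" for z
  proof -
    have "c * c \<le> a * (b + z)" using assms that by (intro mult_mono) auto
    then show ?thesis by (simp add: power2_eq_square)
  qed
  have P: "a * (b + x) + 1 > 0" "a * (b + y) + 1 > 0"
    using ge[of x] ge[of y] assms by (smt (verit) zero_le_power2)+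
  have f: "1 / (a + 1 / (b + z)) = (b + z) / (a * (b + z) + 1)" if "b + z > 0" for z
  proof -
    have "a + 1 / (b + z) = (a * (b + z) + 1) / (b + z)" using that by (simp add: add_divide_distrib)
    then show ?thesis by simp
  qed
  have "1 / (a + 1 / (b + x)) - 1 / (a + 1 / (b + y))
      = (x - y) / ((a * (b + x) + 1) * (a * (b + y) + 1))"
    unfolding f[OF pos(1)] f[OF pos(2)] using P by (simp add: diff_frac_eq) (simp add: algebra_simps)
  then have "\<bar>1 / (a + 1 / (b + x)) - 1 / (a + 1 / (b + y))\<bar>
      = \<bar>x - y\<bar> / ((a * (b + x) + 1) * (a * (b + y) + 1))"
    using P by (simp add: abs_mult)
  also have "\<dots> \<le> \<bar>x - y\<bar> / (1 + c^2)"
  proof (rule divide_left_mono)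
    have "(1 + c^2) * 1 \<le> (a * (b + x) + 1) * (a * (b + y) + 1)"
    proof (rule mult_mono)
      have "0 \<le> c^2" by simp
      then show "1 \<le> a * (b + y) + 1" using ge[OF assms(5)] by linarith
    qed (use ge[OF assms(4)] P in auto)
    then show "1 + c^2 \<le> (a * (b + x) + 1) * (a * (b + y) + 1)" by simp
    show "0 < (a * (b + x) + 1) * (a * (b + y) + 1) * (1 + c\<^sup>2)"
      using P by (intro mult_pos_pos) (auto simp: add_pos_nonneg)
  qed auto
  finally show ?thesis .
qed

lemma cf_tail_contract_even:
  assumes "c > 0" "\<And>n. a n \<ge> c" "t \<ge> 0" "u \<ge> 0"
  shows "\<bar>cf_tail a (2 * n) t - cf_tail a (2 * n) u\<bar> \<le> \<bar>t - u\<bar> * (1 / (1 + c^2)) ^ n"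
  using assms(2)
proof (induction n arbitrary: a)
  case (Suc n)
  let ?b = "\<lambda>k. a (Suc (Suc k))"
  have pos: "\<And>k. a k > 0" using Suc.prems \<open>c > 0\<close> by (meson less_le_trans)
  have "\<bar>cf_tail a (2 * Suc n) t - cf_tail a (2 * Suc n) u\<bar>
      \<le> \<bar>cf_tail ?b (2 * n) t - cf_tail ?b (2 * n) u\<bar> / (1 + c^2)"
    using cf_step2_contract[OF \<open>c > 0\<close> Suc.prems[of 0] Suc.prems[of 1]
        cf_tail_nonneg[of ?b t "2 * n"] cf_tail_nonneg[of ?b u "2 * n"]] pos assms by simp
  also have "\<dots> \<le> (\<bar>t - u\<bar> * (1 / (1 + c^2)) ^ n) / (1 + c^2)"
    using Suc.IH[of ?b] Suc.prems by (intro divide_right_mono) auto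
  finally show ?case by (simp add: field_simps)
qed auto

lemma cf_tail_Suc_snoc: "cf_tail a (Suc n) t = cf_tail a n (1 / (a n + t))"
  by (induction n arbitrary: a) auto

lemma cf_tail_contract:
  assumes "c > 0" "\<And>n. a n \<ge> c" "t \<ge> 0" "u \<ge> 0" "t \<le> B" "u \<le> B" "1 / c \<le> B"
  shows "\<bar>cf_tail a n t - cf_tail a n u\<bar> \<le> B * (1 / (1 + c^2)) ^ (n div 2)"
proof -
  have pos: "\<And>k. a k > 0" using assms by (meson less_le_trans)
  define g where "g = (\<lambda>t. if even n then t else 1 / (a (n - 1) + t))"
  have eq: "cf_tail a n z = cf_tail a (2 * (n div 2)) (g z)" for z
  proof (cases "even n")
    case False
    then obtain m where "n = Suc (2 * m)" by (metis oddE Suc_eq_plus1)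
    then show ?thesis by (simp add: g_def cf_tail_Suc_snoc del: cf_tail.simps)
  qed (simp add: g_def)
  have g: "0 \<le> g z" "g z \<le> B" if "0 \<le> z" "z \<le> B" for z
  proof -
    have "1 / (a (n - 1) + z) \<le> 1 / c"
      using assms(1) assms(2)[of "n - 1"] that by (intro divide_left_mono) auto
    then show "0 \<le> g z" "g z \<le> B"
      using that assms pos[of "n - 1"] by (auto simp: g_def)
  qed
  have "\<bar>cf_tail a n t - cf_tail a n u\<bar> \<le> \<bar>g t - g u\<bar> * (1 / (1 + c^2)) ^ (n div 2)"
    unfolding eq using assms g by (intro cf_tail_contract_even) auto
  also have "\<dots> \<le> B * (1 / (1 + c^2)) ^ (n div 2)"
    using g[of t] g[of u] assms by (intro mult_right_mono) auto
  finally show ?thesis .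
qed

lemma cf_bound_tendsto_0:
  fixes c B :: real
  assumes "c > 0"
  shows "(\<lambda>n. B * (1 / (1 + c^2)) ^ (n div 2)) \<longlonglongrightarrow> 0"
proof -
  have "filterlim (\<lambda>n::nat. n div 2) sequentially sequentially"
    unfolding filterlim_at_top
  proof
    fix Z :: nat
    show "\<forall>\<^sub>F n in sequentially. Z \<le> n div 2"
      using eventually_ge_at_top[of "2 * Z"] by eventually_elim auto
  qed
  moreover have "(\<lambda>n. (1 / (1 + c^2)) ^ n) \<longlonglongrightarrow> 0"
    using assms by (intro LIMSEQ_realpow_zero) (auto simp: add_pos_nonneg)
  ultimately have "(\<lambda>n. (1 / (1 + c^2)) ^ (n div 2)) \<longlonglongrightarrow> 0"
    by (rule filterlim_compose[rotated])
  then show ?thesis by (intro tendsto_mult_right_zero)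
qed

lemma cf_convergent_bounds:
  assumes "c > 0" "\<And>n. a n \<ge> c"
  shows "0 \<le> cf_convergent a n" "cf_convergent a n \<le> 1 / c"
proof -
  have pos: "\<And>k. a k > 0" using assms by (meson less_le_trans)
  show "0 \<le> cf_convergent a n"
    using cf_tail_nonneg pos by (simp add: cf_convergent_eq_tail)
  show "cf_convergent a n \<le> 1 / c"
  proof (cases n)
    case (Suc m)
    have "0 \<le> cf_tail (\<lambda>k. a (Suc k)) m 0" using cf_tail_nonneg pos by simp
    then show ?thesis unfolding Suc cf_convergent_eq_tail cf_tail.simps
      using assms(1) assms(2)[of 0] by (intro divide_left_mono) auto
  qed (use assms in auto)
qed

lemma convergent_cf_convergent:
  assumes c: "c > 0" "\<And>n. a n \<ge> c"
  shows "convergent (cf_convergent a)"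
proof -
  have "Cauchy (cf_convergent a)"
    unfolding Cauchy_altdef
  proof (intro allI impI)
    fix e :: real assume "e > 0"
    then obtain M where M: "\<And>n. n \<ge> M \<Longrightarrow> 1 / c * (1 / (1 + c^2)) ^ (n div 2) < e"
      using order_tendstoD(2)[OF cf_bound_tendsto_0[OF c(1), of "1 / c"], of e]
      by (auto simp: eventually_sequentially)
    show "\<exists>M. \<forall>m\<ge>M. \<forall>n>m. dist (cf_convergent a m) (cf_convergent a n) < e"
    proof (intro exI[of _ M] allI impI)
      fix m n assume mn: "m \<ge> M" "n > m"
      define k where "k = n - m"
      have n: "n = m + k" using mn by (simp add: k_def)
      have "\<bar>cf_convergent a m - cf_convergent a n\<bar> \<le> 1 / c * (1 / (1 + c^2)) ^ (m div 2)"
        unfolding n cf_convergent_add cf_convergent_eq_tail[of a m]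
        using c cf_convergent_bounds[OF c(1), of "\<lambda>i. a (m + i)" k]
        by (intro cf_tail_contract) auto
      then show "dist (cf_convergent a m) (cf_convergent a n) < e"
        using M[OF mn(1)] by (simp add: dist_real_def)
    qed
  qed
  then show ?thesis by (simp add: Cauchy_convergent_iff)
qed

lemma cf_convergent_tendsto_of_tail:
  assumes c: "c > 0" "\<And>n. a n \<ge> c"
    and t: "\<And>n. 0 \<le> t n" "\<And>n. t n \<le> B"
    and x: "\<And>n. cf_tail a n (t n) = x"
  shows "cf_convergent a \<longlonglongrightarrow> x"
proof -
  have B: "0 \<le> max B (1 / c)" using c by (simp add: max.coboundedI2)
  have "\<bar>cf_convergent a n - x\<bar> \<le> max B (1 / c) * (1 / (1 + c^2)) ^ (n div 2)" for n
    unfolding cf_convergent_eq_tail x[of n, symmetric]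
    using c t[of n] B by (intro cf_tail_contract) auto
  then have "(\<lambda>n. cf_convergent a n - x) \<longlonglongrightarrow> 0"
    by (intro Lim_null_comparison[OF _ cf_bound_tendsto_0[OF c(1), of "max B (1 / c)"]]) auto
  then show ?thesis by (simp add: LIM_zero_iff)
qed

context
  fixes A :: "real set" and l h D0 D1 :: real
  assumes l: "0 < l" "l \<in> A" "h \<in> A" "\<And>y. y \<in> A \<Longrightarrow> l \<le> y \<and> y \<le> h"
  defines "D0 \<equiv> (sqrt (l * h * (l * h + 4)) - l * h) / (2 * h)"
    and "D1 \<equiv> (sqrt (l * h * (l * h + 4)) - l * h) / (2 * l)"
begin

lemma cf_extreme_fixpoint: "0 < D0" "D0 \<le> D1" "1 / (h + D1) = D0" "1 / (l + D0) = D1"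
proof -
  have h: "0 < h" "l \<le> h" using l(1) l(4)[OF l(3)] by auto
  define p where "p = l * h"
  define r where "r = sqrt (p * (p + 4)) - p"
  have p: "p > 0" using l(1) h by (simp add: p_def)
  have "p ^ 2 < p * (p + 4)" using p by (simp add: power2_eq_square)
  then have "p < sqrt (p * (p + 4))" using p by (simp add: real_less_rsqrt)
  then have r: "r > 0" by (simp add: r_def)
  have "(r + p) ^ 2 = p * (p + 4)" using p by (simp add: r_def)
  then have rr: "r * (r + 2 * p) = 4 * p" by (simp add: power2_eq_square algebra_simps)
  have D: "D0 = r / (2 * h)" "D1 = r / (2 * l)"
    by (simp_all add: D0_def D1_def r_def p_def)
  show "0 < D0" using r h by (simp add: D)
  show "D0 \<le> D1" unfolding D using r h l(1) by (intro divide_left_mono) auto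
  have "D0 * (h + D1) = r * (r + 2 * p) / (4 * p)" "D1 * (l + D0) = r * (r + 2 * p) / (4 * p)"
    unfolding D p_def using l(1) h(1) by (simp_all add: field_simps)
  then have "D0 * (h + D1) = 1" "D1 * (l + D0) = 1" using rr p by auto
  then show "1 / (h + D1) = D0" "1 / (l + D0) = D1"
    by (metis mult_eq_0_iff nonzero_eq_divide_eq zero_neq_one)+
qed

lemma cf_tail_in_range:
  assumes "\<And>n. a n \<in> A" "t \<in> {D0..D1}"
  shows "cf_tail a n t \<in> {D0..D1}"
  using assms(1)
proof (induction n arbitrary: a)
  case (Suc n)
  have IH: "cf_tail (\<lambda>k. a (Suc k)) n t \<in> {D0..D1}"
    by (rule Suc.IH) (use Suc.prems in simp)
  have "l \<le> a 0" "a 0 \<le> h" using l(4) Suc.prems by auto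
  moreover note cf_extreme_fixpoint
  ultimately have "1 / (h + D1) \<le> cf_tail a (Suc n) t" "cf_tail a (Suc n) t \<le> 1 / (l + D0)"
    using IH l(1) unfolding cf_tail.simps atLeastAtMost_iff by (intro frac_le; linarith)+
  then show ?case using cf_extreme_fixpoint by simp
qed (use assms in auto)

lemma cf_values_bounds:
  assumes "x \<in> cf_values A"
  shows "D0 \<le> x" "x \<le> D1"
proof -
  obtain a where a: "\<And>n. a n \<in> A" "cf_convergent a \<longlonglongrightarrow> x"
    using assms by (auto simp: cf_values_def)
  have c: "a n \<ge> l" for n using l(4) a by blast
  have "\<bar>cf_tail a n D0 - cf_convergent a n\<bar> \<le> max D0 (1 / l) * (1 / (1 + l^2)) ^ (n div 2)" for n
    unfolding cf_convergent_eq_tail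
    using c l(1) cf_extreme_fixpoint(1) by (intro cf_tail_contract) auto
  then have "(\<lambda>n. cf_tail a n D0 - cf_convergent a n) \<longlonglongrightarrow> 0"
    by (intro Lim_null_comparison[OF _ cf_bound_tendsto_0[OF l(1), of "max D0 (1 / l)"]]) auto
  from tendsto_add[OF this a(2)] have lim: "(\<lambda>n. cf_tail a n D0) \<longlonglongrightarrow> x" by simp
  have "cf_tail a n D0 \<in> {D0..D1}" for n
    using cf_tail_in_range[OF a(1)] cf_extreme_fixpoint by auto
  then show "D0 \<le> x" "x \<le> D1"
    using LIMSEQ_le_const[OF lim] LIMSEQ_le_const2[OF lim] by auto
qed

lemma cf_extreme_attained: "D0 \<in> cf_values A" "D1 \<in> cf_values A"
proof -
  define a where "a b n = (if even n = b then h else l)" for b and n :: nat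
  define D where "D b = (if b then D0 else D1)" for b
  have shift: "(\<lambda>k. a b (Suc k)) = a (\<not> b)" for b by (auto simp: a_def fun_eq_iff)
  have tail: "cf_tail (a b) n (D (even n = b)) = D b" for b n
  proof (induction n arbitrary: b)
    case (Suc n)
    have "(even (Suc n) = b) = (even n = (\<not> b))" by auto
    then have "cf_tail (a b) (Suc n) (D (even (Suc n) = b)) = 1 / (a b 0 + D (\<not> b))"
      using Suc.IH[of "\<not> b"] by (simp add: shift)
    also have "\<dots> = D b" using cf_extreme_fixpoint by (auto simp: a_def D_def)
    finally show ?case .
  qed simp
  have "D b \<in> cf_values A" for b
  proof -
    have "a b n \<in> A" for n using l by (auto simp: a_def)
    moreover have "cf_convergent (a b) \<longlonglongrightarrow> D b"
      by (rule cf_convergent_tendsto_of_tail[of l "a b" "\<lambda>n. D (even n = b)" D1, OF l(1) _ _ _ tail])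
        (use l cf_extreme_fixpoint in \<open>auto simp: a_def D_def\<close>)
    ultimately show ?thesis by (auto simp: cf_values_def)
  qed
  from this[of True] this[of False] show "D0 \<in> cf_values A" "D1 \<in> cf_values A"
    by (simp_all add: D_def)
qed

lemma cf_min_eq: "cf_min A = D0"
  unfolding cf_min_def
  using cf_values_bounds cf_extreme_attained by (intro Least_equality) auto

lemma cf_max_eq: "cf_max A = D1"
  unfolding cf_max_def
  using cf_values_bounds cf_extreme_attained by (intro Greatest_equality) auto

end

end

theory Submission
  imports Defs
begin

text \<open>
  Let \<open>lo\<close> and \<open>hi\<close> be the least and the greatest element of the set \<open>E\<close> of values, and \<open>l\<close>, \<open>h\<close>
  the least and the greatest digit. Splitting off the first partial quotient gives
  \<open>E = (\<Union>d\<in>A. {1 / (d + y) | y. y \<in> E})\<close>, so the reciprocals of the elements of \<open>E\<close> form the union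
  of the translates \<open>d + E\<close> with \<open>d \<in> A\<close>. Moreover \<open>1 / hi = l + lo\<close> and \<open>1 / lo = h + hi\<close>.
  Everything follows by comparing the gap between neighbouring digits with the length \<open>hi - lo\<close> of
  the translates of \<open>{lo..hi}\<close>.

  \<^item> If all gaps are at most \<open>hi - lo\<close>, the translates of \<open>{lo..hi}\<close> cover \<open>{l + lo..h + hi}\<close>; hence
    every point of \<open>{lo..hi}\<close> can be expanded digit by digit and \<open>E = {lo..hi}\<close>
    (\<open>cf_values_eq_Icc\<close>). If some gap is larger, the translates miss a point
    (\<open>gap_le_if_Icc\<close>), so \<open>E\<close> is not an interval.
  \<^item> If \<open>E = {lo..hi}\<close> and some gap is smaller than \<open>hi - lo\<close>, two translates overlap in a
    nondegenerate interval, whose uncountably many points all have two representations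
    (\<open>gap_ge_if_zero_redundancy\<close>).
  \<^item> If all gaps are at least \<open>hi - lo\<close>, two translates meet at most in a common end point. So when
    two representations of one number first differ, their remainders have the values \<open>lo\<close> and
    \<open>hi\<close>, each of which has only one representation. This allows at most two representations of
    each number, and two only for the countably many numbers whose expansion has a remainder with
    value \<open>lo\<close> or \<open>hi\<close> (\<open>zero_redundancy_if_separated\<close>).

  If all gaps are equal to \<open>hi - lo\<close>, then \<open>h - l = (s - 1) * (hi - lo)\<close>, and together with the two
  equations for \<open>1 / hi\<close> and \<open>1 / lo\<close> this determines \<open>l * h\<close>.
\<close>

section \<open>Values of continued fractions\<close>

text \<open>The value of an infinite continued fraction; it is only meaningful when the convergents
  converge, as they do for digits bounded below by a positive number.\<close>

definition cf_value :: "(nat \<Rightarrow> real) \<Rightarrow> real" where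
  "cf_value a = lim (cf_convergent a)"

text \<open>Finite continued fractions as a function of the list of partial quotients, which makes the
  countability of the possible beginnings of an expansion visible.\<close>

lemma cf_tail_eq_foldr: "cf_tail a n t = foldr (\<lambda>d y. 1 / (d + y)) (map a [0..<n]) t"
proof (induction n arbitrary: a)
  case (Suc n)
  have "map a [0..<Suc n] = a 0 # map (\<lambda>k. a (Suc k)) [0..<n]"
    by (simp only: upt_conv_Cons map_Suc_upt[symmetric] zero_less_Suc list.map map_map o_def)
  then show ?case using Suc.IH by simp
qed simp

text \<open>A possibly infinite set \<open>A\<close> of positive digits with least element \<open>l\<close> and greatest element \<open>h\<close>; \<open>lo\<close> and \<open>hi\<close>
  abbreviate the extreme values of the infinite continued fractions over \<open>A\<close>.\<close>

locale digit_set =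
  fixes A :: "real set" and l h :: real
  assumes l_pos: "0 < l" and l_in: "l \<in> A" and h_in: "h \<in> A"
    and digit_bounds: "\<And>d. d \<in> A \<Longrightarrow> l \<le> d \<and> d \<le> h"
begin

abbreviation "lo \<equiv> cf_min A"
abbreviation "hi \<equiv> cf_max A"
abbreviation "digit_seq a \<equiv> \<forall>n. a n \<in> A"

lemma digit_pos: "d \<in> A \<Longrightarrow> 0 < d"
  using digit_bounds l_pos by force

lemmas closed_forms = cf_min_eq[OF l_pos l_in h_in digit_bounds]
  cf_max_eq[OF l_pos l_in h_in digit_bounds]

lemma lo_pos: "0 < lo" and lo_le_hi: "lo \<le> hi"
  and lo_fixpoint: "1 / (h + hi) = lo" and hi_fixpoint: "1 / (l + lo) = hi"
  using cf_extreme_fixpoint[OF l_pos l_in h_in digit_bounds] by (simp_all add: closed_forms)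

lemma lo_in: "lo \<in> cf_values A" and hi_in: "hi \<in> cf_values A"
  using cf_extreme_attained[OF l_pos l_in h_in digit_bounds] by (simp_all add: closed_forms)

lemma cf_values_subset: "cf_values A \<subseteq> {lo..hi}"
  using cf_values_bounds[OF l_pos l_in h_in digit_bounds] by (auto simp: closed_forms)

lemma lo_less_hi:
  assumes "l < h"
  shows "lo < hi"
proof -
  have "lo * (h + hi) = 1" "hi * (l + lo) = 1"
    using lo_fixpoint hi_fixpoint lo_pos lo_le_hi l_pos assms by (auto simp: field_simps)
  then have "lo * h = hi * l" by (simp add: algebra_simps)
  moreover have "lo * l < lo * h" using lo_pos assms by simp
  ultimately show ?thesis using l_pos by simp
qed

lemma cf_value_tendsto:
  assumes "digit_seq a"
  shows "cf_convergent a \<longlonglongrightarrow> cf_value a"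
proof -
  have "convergent (cf_convergent a)"
    using assms digit_bounds by (intro convergent_cf_convergent[OF l_pos]) auto
  then show ?thesis by (simp add: cf_value_def convergent_LIMSEQ_iff)
qed

lemma cf_representations_eq: "cf_representations A x = {a. digit_seq a \<and> cf_value a = x}"
proof -
  have "cf_convergent a \<longlonglongrightarrow> x \<longleftrightarrow> cf_value a = x" if "digit_seq a" for a
    using cf_value_tendsto[OF that] LIMSEQ_unique by blast
  then show ?thesis by (fastforce simp: cf_representations_def)
qed

lemma cf_values_eq: "cf_values A = cf_value ` {a. digit_seq a}"
proof -
  have "cf_values A = {x. cf_representations A x \<noteq> {}}"
    by (auto simp: cf_values_def cf_representations_def)
  then show ?thesis by (auto simp: cf_representations_eq)
qed

lemma cf_value_bounds: "digit_seq a \<Longrightarrow> cf_value a \<in> {lo..hi}"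
  using cf_values_subset by (simp add: cf_values_eq image_subset_iff)

lemma digit_seq_shift: "digit_seq a \<Longrightarrow> digit_seq (\<lambda>k. a (n + k))"
  by auto

lemma cf_value_unfold:
  assumes a: "digit_seq a"
  shows "cf_value a = 1 / (a 0 + cf_value (\<lambda>k. a (Suc k)))"
proof -
  let ?b = "\<lambda>k. a (Suc k)"
  have b: "digit_seq ?b" using a by auto
  have "0 < a 0 + cf_value ?b"
    using a digit_pos[of "a 0"] cf_value_bounds[OF b] lo_pos by auto
  then have "(\<lambda>n. 1 / (a 0 + cf_convergent ?b n)) \<longlonglongrightarrow> 1 / (a 0 + cf_value ?b)"
    by (intro tendsto_intros cf_value_tendsto b) auto
  then have "(\<lambda>n. cf_convergent a (Suc n)) \<longlonglongrightarrow> 1 / (a 0 + cf_value ?b)" by simp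
  moreover have "(\<lambda>n. cf_convergent a (Suc n)) \<longlonglongrightarrow> cf_value a"
    using cf_value_tendsto[OF a] by (rule LIMSEQ_Suc)
  ultimately show ?thesis using LIMSEQ_unique by blast
qed

lemma cf_value_eq_tail:
  assumes "digit_seq a"
  shows "cf_value a = cf_tail a n (cf_value (\<lambda>k. a (n + k)))"
  using assms
proof (induction n arbitrary: a)
  case (Suc n)
  have b: "digit_seq (\<lambda>k. a (Suc k))" using Suc.prems by auto
  show ?case using cf_value_unfold[OF Suc.prems] Suc.IH[OF b] by simp
qed simp

lemma inverse_value_bounds:
  assumes "x \<in> {lo..hi}"
  shows "l + lo \<le> 1 / x" "1 / x \<le> h + hi"
proof -
  have "1 / hi \<le> 1 / x" "1 / x \<le> 1 / lo"
    using assms lo_pos by (auto intro!: divide_left_mono)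
  moreover have "1 / hi = l + lo" "1 / lo = h + hi"
    using arg_cong[OF hi_fixpoint, of inverse] arg_cong[OF lo_fixpoint, of inverse]
    by (simp_all add: inverse_eq_divide)
  ultimately show "l + lo \<le> 1 / x" "1 / x \<le> h + hi" by simp_all
qed

lemma inverse_value_mem:
  assumes "u \<in> {l + lo..h + hi}"
  shows "1 / u \<in> {lo..hi}"
proof -
  have "1 / (h + hi) \<le> 1 / u" "1 / u \<le> 1 / (l + lo)"
    using assms l_pos lo_pos by (intro frac_le; simp)+
  then show ?thesis by (simp add: lo_fixpoint hi_fixpoint)
qed

lemma cf_values_unfold: "x \<in> cf_values A \<longleftrightarrow> (\<exists>d\<in>A. \<exists>y\<in>cf_values A. x = 1 / (d + y))"
proof
  assume "x \<in> cf_values A"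
  then obtain a where a: "digit_seq a" "x = cf_value a" by (auto simp: cf_values_eq)
  have "cf_value (\<lambda>k. a (Suc k)) \<in> cf_values A" using a(1) by (auto simp: cf_values_eq)
  then show "\<exists>d\<in>A. \<exists>y\<in>cf_values A. x = 1 / (d + y)"
    using cf_value_unfold[OF a(1)] a by blast
next
  assume "\<exists>d\<in>A. \<exists>y\<in>cf_values A. x = 1 / (d + y)"
  then obtain d a where a: "d \<in> A" "digit_seq a" "x = 1 / (d + cf_value a)"
    by (auto simp: cf_values_eq)
  then have "digit_seq (case_nat d a)" by (auto split: nat.splits)
  moreover from cf_value_unfold[OF this] have "x = cf_value (case_nat d a)" using a by simp
  ultimately show "x \<in> cf_values A" by (auto simp only: cf_values_eq)
qed

section \<open>When the values form an interval\<close>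

lemma is_interval_cf_values_iff: "is_interval (cf_values A) \<longleftrightarrow> cf_values A = {lo..hi}"
proof
  assume "is_interval (cf_values A)"
  then have "{lo..hi} \<subseteq> cf_values A"
    using mem_is_interval_1_I[OF _ lo_in hi_in] by (simp add: subset_iff)
  then show "cf_values A = {lo..hi}" using cf_values_subset by (rule subset_antisym[rotated])
qed (simp add: is_interval_cc)

lemma cf_values_eq_Icc:
  assumes fin: "finite A"
    and gap: "\<And>d. d \<in> A \<Longrightarrow> d \<noteq> h \<Longrightarrow> \<exists>d'\<in>A. d < d' \<and> d' - d \<le> hi - lo"
  shows "cf_values A = {lo..hi}"
proof
  have cover: "\<exists>d\<in>A. 1 / x - d \<in> {lo..hi}" if x: "x \<in> {lo..hi}" for x
  proof -
    define d where "d = Max {d \<in> A. d + lo \<le> 1 / x}"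
    have "d \<in> {d \<in> A. d + lo \<le> 1 / x}"
      unfolding d_def by (rule Max_in) (use fin l_in inverse_value_bounds[OF x] in auto)
    then have d: "d \<in> A" "d + lo \<le> 1 / x" by auto
    have greater: "1 / x < d' + lo" if "d' \<in> A" "d < d'" for d'
    proof (rule ccontr)
      assume "\<not> 1 / x < d' + lo"
      then have "d' \<le> d" unfolding d_def using fin that by (intro Max_ge) auto
      then show False using that by simp
    qed
    have "1 / x \<le> d + hi"
    proof (cases "d = h")
      case True
      then show ?thesis using inverse_value_bounds[OF x] by simp
    next
      case False
      then show ?thesis using gap[OF d(1)] greater by force
    qed
    then show ?thesis using d by (intro bexI[of _ d]) auto
  qed
  \<comment> \<open>The expansion of \<open>x\<close> starts with the digit \<open>dg x\<close> and continues with that of \<open>g x\<close>.\<close>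
  then obtain dg where dg: "\<And>x. x \<in> {lo..hi} \<Longrightarrow> dg x \<in> A \<and> 1 / x - dg x \<in> {lo..hi}"
    by metis
  define g where "g x = 1 / x - dg x" for x
  show "{lo..hi} \<subseteq> cf_values A"
  proof
    fix x assume x: "x \<in> {lo..hi}"
    define t where "t n = (g ^^ n) x" for n
    define a where "a n = dg (t n)" for n
    have t: "t n \<in> {lo..hi}" for n
      by (induction n) (use x dg in \<open>auto simp: t_def g_def\<close>)
    have t_nonneg: "0 \<le> t n" for n using t[of n] lo_pos by auto
    have a: "a n \<in> A" for n using dg[OF t] by (simp add: a_def)
    have step: "t n = 1 / (a n + t (Suc n))" for n by (simp add: t_def a_def g_def)
    have "cf_tail a n (t n) = x" for n
    proof (induction n)
      case (Suc n)
      have "cf_tail a (Suc n) (t (Suc n)) = cf_tail a n (t n)"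
        by (simp only: cf_tail_Suc_snoc flip: step)
      then show ?case using Suc.IH by simp
    qed (simp add: t_def)
    then have "cf_convergent a \<longlonglongrightarrow> x"
      by (rule cf_convergent_tendsto_of_tail[of l a t hi, rotated -1])
        (use l_pos digit_bounds a t t_nonneg in auto)
    then show "x \<in> cf_values A" using a by (auto simp: cf_values_def)
  qed
qed (rule cf_values_subset)

lemma gap_le_if_Icc:
  assumes E: "cf_values A = {lo..hi}"
    and d: "d \<in> A" "d' \<in> A" "d < d'" and consecutive: "A \<inter> {d<..<d'} = {}"
  shows "d' - d \<le> hi - lo"
proof (rule ccontr)
  assume "\<not> d' - d \<le> hi - lo"
  \<comment> \<open>The midpoint of the hole between \<open>d + E\<close> and \<open>d' + E\<close>.\<close>
  define u where "u = (d + hi + (d' + lo)) / 2"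
  have u: "d + hi < u" "u < d' + lo"
    using \<open>\<not> d' - d \<le> hi - lo\<close> by (auto simp: u_def)
  have "u \<in> {l + lo..h + hi}"
    using u digit_bounds[OF d(1)] digit_bounds[OF d(2)] lo_le_hi by auto
  then have "1 / u \<in> cf_values A"
    using inverse_value_mem E by blast
  then obtain c y where c: "c \<in> A" "y \<in> {lo..hi}" "1 / u = 1 / (c + y)"
    unfolding cf_values_unfold[of "1 / u"] using cf_values_subset by blast
  then have "u = c + y" by simp
  then have "d < c" "c < d'" using u c(2) by auto
  then show False using consecutive c(1) by auto
qed

section \<open>When the redundancy is zero\<close>

lemma gap_ge_if_zero_redundancy:
  assumes E: "cf_values A = {lo..hi}" and zr: "zero_redundancy A"
    and d: "d \<in> A" "d' \<in> A" "d < d'"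
  shows "hi - lo \<le> d' - d"
proof (rule ccontr)
  assume less: "\<not> hi - lo \<le> d' - d"
  define C where "C = {x \<in> cf_values A.
       \<exists>a\<in>cf_representations A x. \<exists>b\<in>cf_representations A x. a \<noteq> b}"
  have "u \<in> (\<lambda>x. 1 / x) ` C" if u: "u \<in> {d' + lo<..<d + hi}" for u
  proof -
    have rep: "\<exists>a\<in>cf_representations A (1 / u). a 0 = c" if "c \<in> {d, d'}" for c
    proof -
      have "u - c \<in> {lo..hi}" using u that d by auto
      then obtain a where a: "digit_seq a" "u - c = cf_value a"
        unfolding E[symmetric] cf_values_eq by auto
      have "digit_seq (case_nat c a)" using a that d by (auto split: nat.splits)
      moreover from cf_value_unfold[OF this] have "cf_value (case_nat c a) = 1 / u"
        by (simp flip: a(2))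
      ultimately show ?thesis
        by (intro bexI[of _ "case_nat c a"]) (auto simp: cf_representations_eq)
    qed
    obtain a b where ab: "a \<in> cf_representations A (1 / u)" "b \<in> cf_representations A (1 / u)"
      "a 0 = d" "b 0 = d'"
      using rep[of d] rep[of d'] by auto
    then have "a \<noteq> b" using d by auto
    moreover have "1 / u \<in> cf_values A" using ab(1) by (auto simp: cf_representations_def cf_values_def)
    ultimately have "1 / u \<in> C" using ab unfolding C_def by blast
    then show ?thesis by force
  qed
  then have "{d' + lo<..<d + hi} \<subseteq> (\<lambda>x. 1 / x) ` C" by blast
  moreover have "countable C" using zr by (simp add: zero_redundancy_def C_def)
  ultimately have "countable {d' + lo<..<d + hi}" by (meson countable_image countable_subset)
  then show False using less uncountable_open_interval[of "d' + lo" "d + hi"] by simp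
qed

lemma cf_value_endpoint:
  assumes a: "digit_seq a"
  shows "cf_value a = lo \<Longrightarrow> a 0 = h \<and> cf_value (\<lambda>k. a (Suc k)) = hi"
    and "cf_value a = hi \<Longrightarrow> a 0 = l \<and> cf_value (\<lambda>k. a (Suc k)) = lo"
proof -
  let ?y = "cf_value (\<lambda>k. a (Suc k))"
  have y: "?y \<in> {lo..hi}" using cf_value_bounds[OF digit_seq_shift[OF a, of 1]] by simp
  have a0: "l \<le> a 0" "a 0 \<le> h" using a digit_bounds by auto
  show "a 0 = h \<and> ?y = hi" if "cf_value a = lo"
  proof -
    have "1 / (a 0 + ?y) = 1 / (h + hi)"
      using cf_value_unfold[OF a] that lo_fixpoint by simp
    then have "a 0 + ?y = h + hi" by simp
    then show ?thesis using y a0 by auto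
  qed
  show "a 0 = l \<and> ?y = lo" if "cf_value a = hi"
  proof -
    have "1 / (a 0 + ?y) = 1 / (l + lo)"
      using cf_value_unfold[OF a] that hi_fixpoint by simp
    then have "a 0 + ?y = l + lo" by simp
    then show ?thesis using y a0 by auto
  qed
qed

text \<open>By the preceding lemma the digits of a representation of \<open>lo\<close> or \<open>hi\<close> are forced to alternate
  between \<open>l\<close> and \<open>h\<close>.\<close>

lemma endpoint_representation_unique:
  assumes "digit_seq a" "digit_seq b" "cf_value a = cf_value b" "cf_value a \<in> {lo, hi}"
  shows "a = b"
proof
  fix n
  show "a n = b n" using assms
  proof (induction n arbitrary: a b)
    case 0
    then show ?case using cf_value_endpoint[of a] cf_value_endpoint[of b] by auto
  next
    case (Suc n)
    have "cf_value (\<lambda>k. a (Suc k)) = cf_value (\<lambda>k. b (Suc k)) \<and> cf_value (\<lambda>k. a (Suc k)) \<in> {lo, hi}"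
      using cf_value_endpoint[of a] cf_value_endpoint[of b] Suc.prems by auto
    then show ?case
      using Suc.IH[of "\<lambda>k. a (Suc k)" "\<lambda>k. b (Suc k)"] Suc.prems by auto
  qed
qed

lemma cf_value_shift_eq:
  assumes "digit_seq a" "digit_seq b" "cf_value a = cf_value b" "\<And>i. i < n \<Longrightarrow> a i = b i"
  shows "cf_value (\<lambda>k. a (n + k)) = cf_value (\<lambda>k. b (n + k))"
  using assms
proof (induction n arbitrary: a b)
  case (Suc n)
  have "cf_value (\<lambda>k. a (Suc k)) = cf_value (\<lambda>k. b (Suc k))"
    using cf_value_unfold[of a] cf_value_unfold[of b] Suc.prems(1-3) Suc.prems(4)[of 0] by simp
  then show ?case
    using Suc.IH[of "\<lambda>k. a (Suc k)" "\<lambda>k. b (Suc k)"] Suc.prems by auto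
qed simp

text \<open>The digit sequences \<open>a\<close> and \<open>b\<close> agree before the index \<open>n\<close> and differ at \<open>n\<close>.\<close>

definition first_difference :: "(nat \<Rightarrow> real) \<Rightarrow> (nat \<Rightarrow> real) \<Rightarrow> nat \<Rightarrow> bool" where
  "first_difference a b n \<longleftrightarrow> (\<forall>i<n. a i = b i) \<and> a n \<noteq> b n"

lemma first_difference_exists: "a \<noteq> b \<Longrightarrow> \<exists>n. first_difference a b n"
  unfolding first_difference_def fun_eq_iff
  using exists_least_iff[of "\<lambda>n. a n \<noteq> b n"] by blast

lemma first_difference_sym: "first_difference a b n \<longleftrightarrow> first_difference b a n"
  by (auto simp: first_difference_def)

context
  assumes separated: "\<And>d d'. d \<in> A \<Longrightarrow> d' \<in> A \<Longrightarrow> d < d' \<Longrightarrow> hi - lo \<le> d' - d"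
begin

text \<open>Two representations of one number have \<open>a n + y = b n + z\<close> at the first difference, where the
  remainders \<open>y\<close> and \<open>z\<close> lie in \<open>{lo..hi}\<close>; since \<open>b n - a n \<ge> hi - lo\<close>, they must be the end
  points.\<close>

lemma remainders_at_first_difference:
  assumes ab: "digit_seq a" "digit_seq b" "cf_value a = cf_value b"
    and fd: "first_difference a b n" and less: "a n < b n"
  shows "cf_value (\<lambda>k. a (Suc n + k)) = hi" "cf_value (\<lambda>k. b (Suc n + k)) = lo"
proof -
  let ?y = "\<lambda>a. cf_value (\<lambda>k. a (Suc n + k))"
  have unfold: "cf_value (\<lambda>k. c (n + k)) = 1 / (c n + ?y c)" if "digit_seq c" for c
    using cf_value_unfold[OF digit_seq_shift[OF that, of n]] by simp
  have "cf_value (\<lambda>k. a (n + k)) = cf_value (\<lambda>k. b (n + k))"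
    using cf_value_shift_eq[OF ab] fd by (simp add: first_difference_def)
  then have "a n + ?y a = b n + ?y b" by (simp add: unfold ab)
  moreover have "hi - lo \<le> b n - a n" using separated less ab by auto
  moreover have "?y a \<in> {lo..hi}" "?y b \<in> {lo..hi}"
    by (intro cf_value_bounds digit_seq_shift ab)+
  ultimately show "?y a = hi" "?y b = lo" by auto
qed

lemma remainder_endpoint:
  assumes ab: "digit_seq a" "digit_seq b" "cf_value a = cf_value b"
    and fd: "first_difference a b n"
  shows "cf_value (\<lambda>k. a (Suc n + k)) \<in> {lo, hi}"
proof (cases "a n < b n")
  case True
  then show ?thesis using remainders_at_first_difference[OF ab fd] by simp
next
  case False
  then have "b n < a n" using fd by (auto simp: first_difference_def)
  then show ?thesis
    using remainders_at_first_difference[OF ab(2,1) ab(3)[symmetric]] fd first_difference_sym by simp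
qed

text \<open>Two other representations \<open>b\<close>, \<open>c\<close> of the value of \<open>a\<close> part from \<open>a\<close> at the same place: behind
  the place where \<open>c\<close> parts from \<open>a\<close>, the remainder of \<open>a\<close> is an extreme value and has only one
  representation, so \<open>b\<close> cannot part from \<open>a\<close> later.\<close>

lemma first_difference_le:
  assumes a: "digit_seq a" and b: "digit_seq b" "cf_value a = cf_value b"
    and c: "digit_seq c" "cf_value a = cf_value c"
    and n: "first_difference a b n" and m: "first_difference a c m"
  shows "n \<le> m"
proof (rule ccontr)
  assume "\<not> n \<le> m"
  then have less: "m < n" by simp
  have agree: "a i = b i" if "i < Suc m" for i
    using n less that by (auto simp: first_difference_def)
  have "cf_value (\<lambda>k. a (Suc m + k)) = cf_value (\<lambda>k. b (Suc m + k))"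
    by (rule cf_value_shift_eq[OF a b agree])
  then have "(\<lambda>k. a (Suc m + k)) = (\<lambda>k. b (Suc m + k))"
    using remainder_endpoint[OF a c m]
    by (intro endpoint_representation_unique digit_seq_shift a b)
  from fun_cong[OF this, of "n - Suc m"] have "a n = b n" using less by simp
  then show False using n by (simp add: first_difference_def)
qed

lemma first_difference_eq:
  assumes "digit_seq a" "digit_seq b" "cf_value a = cf_value b" "digit_seq c" "cf_value a = cf_value c"
    and "first_difference a b n" "first_difference a c m"
  shows "m = n"
  using first_difference_le[OF assms(1-7)] first_difference_le[OF assms(1,4,5,2,3,7,6)]
  by simp

lemma no_three_representations:
  assumes lh: "l < h"
    and a: "digit_seq a" and b: "digit_seq b" and c: "digit_seq c"
    and vals: "cf_value a = cf_value b" "cf_value a = cf_value c"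
    and ne: "a \<noteq> b" "a \<noteq> c" "b \<noteq> c"
  shows False
proof -
  obtain n m k where n: "first_difference a b n" and m: "first_difference a c m"
    and k: "first_difference b c k"
    using first_difference_exists ne by meson
  have n': "first_difference b a n" using n first_difference_sym by blast
  have "m = n" by (rule first_difference_eq[OF a b vals(1) c vals(2) n m])
  moreover have "k = n"
    by (rule first_difference_eq[OF b a vals(1)[symmetric] c _ n' k]) (use vals in metis)
  ultimately have fd: "first_difference u v n"
    if "u \<in> {a, b, c}" "v \<in> {a, b, c}" "u \<noteq> v" for u v
    using that n m k first_difference_sym by blast
  have rep: "digit_seq u \<and> cf_value u = cf_value a" if "u \<in> {a, b, c}" for u
    using that a b c vals by (metis empty_iff insert_iff)
  \<comment> \<open>The remainder of the representation with the middle digit would have both values \<open>lo\<close> and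
    \<open>hi\<close>.\<close>
  have mid: False
    if mem: "u \<in> {a, b, c}" "v \<in> {a, b, c}" "w \<in> {a, b, c}" and less: "u n < v n" "v n < w n"
    for u v w
  proof -
    have ne: "u \<noteq> v" "v \<noteq> w" using less by auto
    have val: "cf_value u = cf_value v" "cf_value v = cf_value w"
      using rep[OF mem(1)] rep[OF mem(2)] rep[OF mem(3)] by simp_all
    have "cf_value (\<lambda>k. v (Suc n + k)) = lo"
      using remainders_at_first_difference(2)[OF _ _ val(1) fd[OF mem(1,2) ne(1)] less(1)]
        rep[OF mem(1)] rep[OF mem(2)] by blast
    moreover have "cf_value (\<lambda>k. v (Suc n + k)) = hi"
      using remainders_at_first_difference(1)[OF _ _ val(2) fd[OF mem(2,3) ne(2)] less(2)]
        rep[OF mem(2)] rep[OF mem(3)] by blast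
    ultimately show False using lo_less_hi[OF lh] by simp
  qed
  have "a n \<noteq> b n" "a n \<noteq> c n" "b n \<noteq> c n"
    using fd[of a b] fd[of a c] fd[of b c] ne by (simp_all add: first_difference_def)
  then consider "a n < b n" "b n < c n" | "a n < c n" "c n < b n" | "b n < a n" "a n < c n"
    | "b n < c n" "c n < a n" | "c n < a n" "a n < b n" | "c n < b n" "b n < a n"
    by linarith
  then show False by cases (use mid in blast)+
qed

lemma zero_redundancy_if_separated:
  assumes "countable A" and lh: "l < h"
  shows "zero_redundancy A"
  unfolding zero_redundancy_def
proof
  show "\<forall>x\<in>cf_values A. finite (cf_representations A x) \<and> card (cf_representations A x) \<le> 2"
  proof
    fix x
    have "\<exists>a b. cf_representations A x \<subseteq> {a, b}"
    proof (rule ccontr)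
      assume none: "\<not> (\<exists>a b. cf_representations A x \<subseteq> {a, b})"
      then obtain a where a: "a \<in> cf_representations A x" by blast
      obtain b where b: "b \<in> cf_representations A x" "a \<noteq> b" using none by blast
      obtain c where c: "c \<in> cf_representations A x" "a \<noteq> c" "b \<noteq> c" using none by blast
      show False
        using no_three_representations[OF lh, of a b c] a b c by (auto simp: cf_representations_eq)
    qed
    then obtain a b where "cf_representations A x \<subseteq> {a, b}" by blast
    then show "finite (cf_representations A x) \<and> card (cf_representations A x) \<le> 2"
      using card_mono[of "{a, b}"] card_insert_le_m1[of 2 "{b}" a]
      by (auto intro: finite_subset order_trans)
  qed
  let ?f = "\<lambda>(ds, t). foldr (\<lambda>d y. 1 / (d + y)) ds t"
  have "{x \<in> cf_values A. \<exists>a\<in>cf_representations A x. \<exists>b\<in>cf_representations A x. a \<noteq> b}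
      \<subseteq> ?f ` (lists A \<times> {lo, hi})"
  proof clarify
    fix x a b
    assume "a \<in> cf_representations A x" "b \<in> cf_representations A x" "a \<noteq> b"
    then have a: "digit_seq a" "cf_value a = x" and b: "digit_seq b" "cf_value a = cf_value b"
      by (auto simp: cf_representations_eq)
    obtain n where n: "first_difference a b n" using first_difference_exists \<open>a \<noteq> b\<close> by blast
    have "x = ?f (map a [0..<Suc n], cf_value (\<lambda>k. a (Suc n + k)))"
      using cf_value_eq_tail[OF a(1), of "Suc n"] a(2) unfolding cf_tail_eq_foldr by simp
    moreover have "map a [0..<Suc n] \<in> lists A" using a(1) by auto
    ultimately show "x \<in> ?f ` (lists A \<times> {lo, hi})"
      using remainder_endpoint[OF a(1) b n] by blast
  qed
  moreover have "countable (?f ` (lists A \<times> {lo, hi}))"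
    using \<open>countable A\<close> by (intro countable_image countable_SIGMA countable_lists) auto
  ultimately show "countable {x \<in> cf_values A.
      \<exists>a\<in>cf_representations A x. \<exists>b\<in>cf_representations A x. a \<noteq> b}"
    by (rule countable_subset)
qed

end

section \<open>The product of the extreme digits\<close>

lemma extreme_digits_product:
  assumes lh: "l < h" and m: "h - l = m * (hi - lo)"
  shows "l * h = m\<^sup>2 / (m + 1)"
proof -
  \<comment> \<open>Both extreme values are the same multiple \<open>k\<close> of the extreme digits, and \<open>k = 1 / m\<close>.\<close>
  define k where "k = lo / l"
  have fix_eqs: "lo * (h + hi) = 1" "hi * (l + lo) = 1"
    using lo_fixpoint hi_fixpoint lo_pos lo_le_hi l_pos lh by (auto simp: field_simps)
  have lo: "lo = k * l" using l_pos by (simp add: k_def)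
  have "hi * l = lo * h" using fix_eqs by (simp add: algebra_simps)
  then have hi: "hi = k * h" using l_pos by (simp add: k_def field_simps)
  have "(h - l) * (m * k) = (h - l) * 1" using m unfolding lo hi by (simp add: algebra_simps)
  then have mk: "m * k = 1" using lh by simp
  have "0 < k" using lo_pos l_pos by (simp add: k_def)
  then have "0 < m" using mk by (metis zero_less_mult_pos2 zero_less_one)
  have "k * l * (h + k * h) = 1" using fix_eqs(1) unfolding lo hi .
  moreover have "(m * k) * (l * h) * (m + m * k) = m\<^sup>2 * (k * l * (h + k * h))"
    by (simp add: power2_eq_square algebra_simps)
  ultimately have "l * h * (m + 1) = m\<^sup>2" unfolding mk by simp
  then show ?thesis using \<open>0 < m\<close> by (simp add: field_simps)
qed

end

section \<open>Digits in arithmetic progression\<close>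

theorem theorem23:
  fixes s :: nat and e :: "nat \<Rightarrow> real" and A :: "real set"
  assumes "s \<ge> 2"
    and "0 < e 0"
    and "\<And>i. Suc i < s \<Longrightarrow> e i < e (Suc i)"
    and "A = e ` {..<s}"
  shows "((is_interval (cf_values A) \<and> zero_redundancy A) \<longleftrightarrow>
      (\<forall>i\<in>{1..s-1}. e i - e (i - 1) = cf_max A - cf_min A)) \<and>
    ((\<forall>i\<in>{1..s-1}. e i - e (i - 1) = cf_max A - cf_min A) \<longrightarrow>
      e 0 * e (s - 1) = (real s - 1)\<^sup>2 / real s)"
proof -
  have mono: "e i < e j" if "i < j" "j < s" for i j
    using that
  proof (induction j)
    case (Suc j)
    then show ?case using assms(3)[of j] by (cases "i = j") auto
  qed simp
  have mono_iff: "e i < e j \<longleftrightarrow> i < j" if "i < s" "j < s" for i j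
    using that mono[of i j] mono[of j i] by (cases i j rule: linorder_cases) auto
  have mono_le: "e i \<le> e j" if "i \<le> j" "j < s" for i j
    using that mono[of i j] by (cases "i = j") auto
  interpret digit_set A "e 0" "e (s - 1)"
    by unfold_locales (use assms mono_le in auto)
  have lh: "e 0 < e (s - 1)" using mono assms(1) by simp
  define w where "w = hi - lo"
  let ?AP = "\<forall>i\<in>{1..s-1}. e i - e (i - 1) = hi - lo"
  have step: "e (Suc i) - e i = w" if ?AP "Suc i < s" for i
    using bspec[OF that(1), of "Suc i"] that(2) by (simp add: w_def)
  have "?AP" if E: "is_interval (cf_values A)" and zr: "zero_redundancy A"
  proof
    fix i assume "i \<in> {1..s-1}"
    then obtain j where j: "i = Suc j" "Suc j < s" by (cases i) auto
    have "A \<inter> {e j<..<e (Suc j)} = {}"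
      using j mono_iff assms(4) by auto
    then show "e i - e (i - 1) = hi - lo"
      using gap_le_if_Icc[of "e j" "e (Suc j)"] gap_ge_if_zero_redundancy[of "e j" "e (Suc j)"]
        j assms(3)[of j] assms(4) E zr is_interval_cf_values_iff by auto
  qed
  moreover have "is_interval (cf_values A)" if AP: ?AP
    unfolding is_interval_cf_values_iff
  proof (rule cf_values_eq_Icc)
    fix d assume "d \<in> A" "d \<noteq> e (s - 1)"
    then obtain i where i: "d = e i" "i < s" "i \<noteq> s - 1" using assms(4) by auto
    then have "Suc i < s" by simp
    then show "\<exists>d'\<in>A. d < d' \<and> d' - d \<le> hi - lo"
      using step[OF AP] assms(3,4) i by (intro bexI[of _ "e (Suc i)"]) (auto simp: w_def)
  qed (simp add: assms(4))
  moreover have "zero_redundancy A" if AP: ?AP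
  proof (rule zero_redundancy_if_separated)
    fix d d' assume "d \<in> A" "d' \<in> A" "d < d'"
    then obtain i j where ij: "d = e i" "d' = e j" "j < s" "i < j"
      using assms(4) mono_iff by auto
    then show "hi - lo \<le> d' - d"
      using step[OF AP, of i] mono_le[of "Suc i" j] by (simp add: w_def)
  qed (use lh in \<open>simp_all add: assms(4) countable_finite\<close>)
  moreover have "e 0 * e (s - 1) = (real s - 1)\<^sup>2 / real s" if AP: ?AP
  proof -
    have "e i - e 0 = real i * w" if "i < s" for i
      using that
    proof (induction i)
      case (Suc i)
      then show ?case using step[OF AP, of i] by (simp add: algebra_simps)
    qed simp
    from this[of "s - 1"] show ?thesis
      using extreme_digits_product[OF lh, of "real s - 1"] assms(1) by (simp add: w_def of_nat_diff)
  qed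
  ultimately show ?thesis by blast
qed

end
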